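(* For any topological space $X$ of countable tightness, each $\sigma$-convex subset $\mathcal F\subset SC_p(X)$ (with the subspace topology) has network weight $nw(\mathcal F)\le nw(X)$. Moreover, $$nw(X)=\max\{nw(\mathcal F):\mathcal F\text{ is a }\sigma\text{-convex subset of }SC_p(X)\}$$ provided the space $X$ is Tychonoff.
   Context: A function $f:X\to Y$ between topological spaces is scatteredly continuous if for each non-empty subspace $A\subset X$ the restriction $f|A:A\to Y$ has a point of continuity. $SC_p(X)\subset\mathbb R^X$ denotes the linear space of all scatteredly continuous real-valued functions on $X$, endowed with the topology of pointwise convergence. A subset $C$ of a linear topological space $L$ is $\sigma$-convex if for any sequence $(x_n)_{n\in\omega}$ in $C$ and any sequence of positive real numbers $(t_n)_{n\in\omega}$ with $\sum_{n=0}^\infty t_n=1$ the series $\sum_{n=0}^\infty t_nx_n$ converges to some point $c\in C$. A network of a topological space is a family $\mathcal N$ of subsets such that for each open set $U$ and each $x\in U$ there is $N\in\mathcal N$ with $x\in N\subset U$. The network weight $nw(X)$ of a topological space $X$ is the smallest cardinality of a network of the topology of $X$. The tightness $t(X)$ is the smallest infinite cardinal $\kappa$ such that for each subset $A\subset X$ and each point $a\in\bar A$ there is a subset $B\subset A$ of cardinality $|B|\le\kappa$ with $a\in\bar B$; $X$ has countable tightness if $t(X)=\aleph_0$.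
   Formalization: Network weight is taken to be at least ℵ₀ (finite values are replaced by ℵ₀); with the literal smallest cardinality the claim fails, e.g. for a one-point X, where nw(X)=1 but the σ-convex set [0,1] in SC_p(X) has network weight ℵ₀. *)

theory Defs
  imports "HOL-Analysis.Analysis" "HOL-Library.Function_Algebras"
begin

unbundle cardinal_syntax
no_notation Set_Algebras.elt_set_eq (infix "=o" 50)

text \<open>
  Together with the topology of pointwise convergence (the topology of type
  \<^typ>\<open>'a \<Rightarrow> real\<close> in the library), the following makes the real-valued functions a
  linear topological space in the sense of the type classes.
\<close>

instantiation "fun" :: (type, real_vector) real_vector
begin

definition "scaleR r f = (\<lambda>x. r *\<^sub>R f x)"

instance
  by standard (simp_all add: scaleR_fun_def fun_eq_iff scaleR_add_right scaleR_add_left)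

end

lemma scaleR_fun_apply [simp]: "(r *\<^sub>R f) x = r *\<^sub>R f x"
  by (simp add: scaleR_fun_def)

definition scatteredly_continuous :: "'a topology \<Rightarrow> 'b topology \<Rightarrow> ('a \<Rightarrow> 'b) \<Rightarrow> bool" where
  "scatteredly_continuous X Y f \<longleftrightarrow>
     f \<in> topspace X \<rightarrow> topspace Y \<and>
     (\<forall>A. A \<subseteq> topspace X \<and> A \<noteq> {} \<longrightarrow> (\<exists>x\<in>A. topcontinuous_at (subtopology X A) Y f x))"

text \<open>
  A real-valued function on \<open>topspace X\<close> is represented by its extension by zero to the
  whole type. This embeds the power of the real line with exponent \<open>topspace X\<close> linearly and
  homeomorphically into \<^typ>\<open>'a \<Rightarrow> real\<close>.
\<close>

definition SCp :: "'a topology \<Rightarrow> ('a \<Rightarrow> real) topology" where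
  "SCp X = subtopology euclidean
     {f. scatteredly_continuous X euclideanreal f \<and> (\<forall>x. x \<notin> topspace X \<longrightarrow> f x = 0)}"

definition sigma_convex :: "'b::{real_vector,topological_space} set \<Rightarrow> bool" where
  "sigma_convex C \<longleftrightarrow>
     (\<forall>(x :: nat \<Rightarrow> 'b) (t :: nat \<Rightarrow> real).
        (\<forall>n. x n \<in> C) \<and> (\<forall>n. t n > 0) \<and> t sums 1
        \<longrightarrow> (\<exists>c\<in>C. (\<lambda>n. t n *\<^sub>R x n) sums c))"

definition is_network :: "'a topology \<Rightarrow> 'a set set \<Rightarrow> bool" where
  "is_network X \<N> \<longleftrightarrow>
     \<N> \<subseteq> Pow (topspace X) \<and>
     (\<forall>U x. openin X U \<and> x \<in> U \<longrightarrow> (\<exists>N\<in>\<N>. x \<in> N \<and> N \<subseteq> U))"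

definition is_minimal_network :: "'a topology \<Rightarrow> 'a set set \<Rightarrow> bool" where
  "is_minimal_network X \<N> \<longleftrightarrow>
     is_network X \<N> \<and> (\<forall>\<M>. is_network X \<M> \<longrightarrow> |\<N>| \<le>o |\<M>| )"

text \<open>
  As usual for cardinal functions in topology, values are taken to be infinite: the summand
  \<^term>\<open>natLeq\<close> replaces a finite value by \<open>\<aleph>\<^sub>0\<close> and does not change an infinite one.
  Without this convention a one-point space would have network weight 1, less than the
  network weight of the \<open>\<sigma>\<close>-convex set of all functions on it with values in \<open>[0, 1]\<close>.
\<close>

definition network_weight :: "'a topology \<Rightarrow> (nat + 'a set) rel" where
  "network_weight X = natLeq +c |SOME \<N>. is_minimal_network X \<N>|"

definition tightness_le :: "'a topology \<Rightarrow> 'k rel \<Rightarrow> bool" where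
  "tightness_le X \<kappa> \<longleftrightarrow>
     (\<forall>A a. A \<subseteq> topspace X \<and> a \<in> X closure_of A
        \<longrightarrow> (\<exists>B. B \<subseteq> A \<and> |B| \<le>o \<kappa> \<and> a \<in> X closure_of B))"

text \<open>
  The tightness is at most the larger of \<open>\<aleph>\<^sub>0\<close> and the cardinality of the space, so it is
  enough to look at cardinals on the type \<^typ>\<open>nat + 'a\<close>.
\<close>

definition is_tightness :: "'a topology \<Rightarrow> (nat + 'a) rel \<Rightarrow> bool" where
  "is_tightness X \<kappa> \<longleftrightarrow>
     Cinfinite \<kappa> \<and> tightness_le X \<kappa> \<and>
     (\<forall>\<mu> :: (nat + 'a) rel. Cinfinite \<mu> \<and> tightness_le X \<mu> \<longrightarrow> \<kappa> \<le>o \<mu>)"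

definition tightness :: "'a topology \<Rightarrow> (nat + 'a) rel" where
  "tightness X = (SOME \<kappa>. is_tightness X \<kappa>)"

definition countable_tightness :: "'a topology \<Rightarrow> bool" where
  "countable_tightness X \<longleftrightarrow> tightness X =o natLeq"

definition tychonoff_space :: "'a topology \<Rightarrow> bool" where
  "tychonoff_space X \<longleftrightarrow> completely_regular_space X \<and> Hausdorff_space X"

definition is_maximum_cardinal :: "'k rel \<Rightarrow> 'l rel set \<Rightarrow> bool" where
  "is_maximum_cardinal \<kappa> K \<longleftrightarrow> (\<exists>\<mu>\<in>K. \<kappa> =o \<mu>) \<and> (\<forall>\<mu>\<in>K. \<mu> \<le>o \<kappa>)"


lemma is_minimal_network_exists: "\<exists>\<N>. is_minimal_network X \<N>"
proof -
  let ?R = "{|\<N>| | \<N>. is_network X \<N>}"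
  have "is_network X (Pow (topspace X))"
    unfolding is_network_def using openin_subset by fast
  then have "?R \<noteq> {}" by blast
  moreover have "\<forall>r\<in>?R. Card_order r"
    using card_of_Card_order by blast
  ultimately obtain r where "r \<in> ?R" "\<forall>r'\<in>?R. r \<le>o r'"
    using exists_minim_Card_order[of ?R] by blast
  then show ?thesis
    unfolding is_minimal_network_def by blast
qed

lemma countable_iff_card_le_natLeq: "countable A \<longleftrightarrow> |A| \<le>o natLeq"
proof -
  have "countable A \<longleftrightarrow> |A| \<le>o |UNIV :: nat set|"
    unfolding countable_def card_of_ordLeq[symmetric] by simp
  then show ?thesis
    using card_of_nat ordLeq_ordIso_trans ordIso_symmetric by blast
qed

lemma Cinfinite_card_of: "infinite A \<Longrightarrow> Cinfinite |A|"
  unfolding cinfinite_def Field_card_of by (intro conjI card_of_card_order_on)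

lemma network_weight_eq_infinite:
  assumes "is_minimal_network X \<N>" "infinite \<N>"
  shows "network_weight X =o |\<N>|"
proof -
  let ?S = "SOME \<N>. is_minimal_network X \<N>"
  have S: "is_minimal_network X ?S"
    using assms(1) by (rule someI)
  then have eq: "|?S| =o |\<N>|"
    using assms(1) unfolding is_minimal_network_def ordIso_iff_ordLeq by blast
  have inf: "natLeq \<le>o |\<N>|"
    using assms(2) infinite_iff_natLeq_ordLeq by blast
  have "network_weight X =o natLeq +c |\<N>|"
    unfolding network_weight_def by (rule csum_cong2[OF eq])
  also have "natLeq +c |\<N>| =o |\<N>|"
    by (rule csum_absorb2[OF Cinfinite_card_of[OF assms(2)] inf])
  finally show ?thesis .
qed

lemma network_weight_eq_countable:
  assumes "is_network X \<N>" "countable \<N>"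
  shows "network_weight X =o natLeq"
proof -
  let ?S = "SOME \<N>. is_minimal_network X \<N>"
  have "is_minimal_network X ?S"
    using is_minimal_network_exists by (rule someI_ex)
  then have "|?S| \<le>o |\<N>|"
    using assms(1) unfolding is_minimal_network_def by blast
  also have "|\<N>| \<le>o natLeq"
    using assms(2) by (simp add: countable_iff_card_le_natLeq)
  finally have le: "|?S| \<le>o natLeq" .
  show ?thesis
    unfolding network_weight_def by (rule csum_absorb1[OF natLeq_Cinfinite le])
qed

lemma is_tightness_tightness: "is_tightness X (tightness X)"
proof -
  let ?R = "{\<kappa> :: (nat + 'a) rel. Cinfinite \<kappa> \<and> tightness_le X \<kappa>}"
  let ?U = "|UNIV :: (nat + 'a) set|"
  have "|B| \<le>o ?U" for B :: "'a set"
    by (rule card_of_ordLeqI[of Inr]) auto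
  then have "tightness_le X ?U"
    unfolding tightness_le_def by blast
  moreover have "Cinfinite ?U"
    by (rule Cinfinite_card_of) simp
  ultimately have "?R \<noteq> {}" by blast
  then obtain r where "r \<in> ?R" "\<forall>r'\<in>?R. r \<le>o r'"
    using exists_minim_Card_order[of ?R] by blast
  then have "is_tightness X r"
    unfolding is_tightness_def by blast
  then show ?thesis
    unfolding tightness_def by (rule someI)
qed

lemma tightness_le_mono:
  "tightness_le X \<kappa> \<Longrightarrow> \<kappa> \<le>o \<mu> \<Longrightarrow> tightness_le X \<mu>"
  unfolding tightness_le_def by (meson ordLeq_transitive)

lemma countable_tightness_iff:
  "countable_tightness X \<longleftrightarrow>
     (\<forall>A a. A \<subseteq> topspace X \<and> a \<in> X closure_of A
        \<longrightarrow> (\<exists>B. B \<subseteq> A \<and> countable B \<and> a \<in> X closure_of B))"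
proof -
  have t: "is_tightness X (tightness X)" by (rule is_tightness_tightness)
  have ge: "natLeq \<le>o tightness X"
    using t unfolding is_tightness_def by (simp add: natLeq_ordLeq_cinfinite)
  have "countable_tightness X \<longleftrightarrow> tightness_le X natLeq"
  proof
    assume "countable_tightness X"
    then show "tightness_le X natLeq"
      using t tightness_le_mono ordIso_imp_ordLeq
      unfolding countable_tightness_def is_tightness_def by blast
  next
    assume le: "tightness_le X natLeq"
    let ?\<omega> = "|range (Inl :: nat \<Rightarrow> nat + 'a)|"
    have iso: "?\<omega> =o natLeq"
    proof -
      have "bij_betw (Inl :: nat \<Rightarrow> nat + 'a) UNIV (range Inl)"
        by (simp add: bij_betw_def)
      then have "|UNIV :: nat set| =o ?\<omega>"
        using card_of_ordIso by blast
      then show ?thesis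
        using card_of_nat ordIso_symmetric ordIso_transitive by blast
    qed
    then have "Cinfinite ?\<omega>"
      using Cinfinite_cong natLeq_Cinfinite ordIso_symmetric by blast
    moreover have "tightness_le X ?\<omega>"
      using le tightness_le_mono iso ordIso_iff_ordLeq by blast
    ultimately have "tightness X \<le>o ?\<omega>"
      using t unfolding is_tightness_def by blast
    then show "countable_tightness X"
      using iso ge ordLeq_ordIso_trans ordIso_iff_ordLeq
      unfolding countable_tightness_def by blast
  qed
  then show ?thesis
    unfolding tightness_le_def countable_iff_card_le_natLeq .
qed

end

theory Submission
  imports Defs
begin

text \<open>
  A \<open>\<sigma>\<close>-convex family \<open>\<F>\<close> is pointwise bounded, so \<open>X\<close> is a countable union of sets on each
  of which \<open>\<F>\<close> is uniformly bounded. On such a set \<open>\<F>\<close> is collectively weakly discontinuous: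
  every nonempty subset \<open>A\<close> has a nonempty relatively open part on which all members of \<open>\<F>\<close>
  are continuous. Otherwise countable tightness yields a countable \<open>Q \<subseteq> A\<close> and countably many
  members of \<open>\<F>\<close> whose discontinuities on \<open>Q\<close> are dense, and a suitable \<open>\<sigma>\<close>-convex
  combination of them retains all these discontinuities and is not scatteredly continuous.
  Without uniform boundedness the tail of the combination could cancel the discontinuities.

  Consequently, for any network of \<open>X\<close>, there is a family of subsets of at most the same
  (infinite) cardinality which is a network for the topology on \<open>X\<close> generated by \<open>\<F>\<close>. The
  functions sending finitely many of its members into rational intervals give a network of
  \<open>\<F>\<close>. For completely regular \<open>X\<close> the bound is attained by the continuous functions with
  values in \<open>[0, 1]\<close>.
\<close>

section \<open>Cardinal arithmetic and bounds for the network weight\<close>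

lemma card_of_image_le: "|A| \<le>o r \<Longrightarrow> |f ` A| \<le>o r"
  using card_of_image ordLeq_transitive by blast

lemma countable_card_of_le: "countable A \<Longrightarrow> Cinfinite r \<Longrightarrow> |A| \<le>o r"
  using countable_iff_card_le_natLeq natLeq_ordLeq_cinfinite ordLeq_transitive by blast

text \<open>Inserting one element of \<open>A\<close> turns the subsets of size \<open>n\<close>
  into those of size \<open>Suc n\<close>, and an infinite \<open>r\<close> is closed under unions
  of at most \<open>r\<close> sets of size at most \<open>r\<close>.\<close>

lemma card_of_finite_subsets:
  assumes r: "Cinfinite r" and A: "|A| \<le>o r"
  shows "|{T. finite T \<and> T \<subseteq> A}| \<le>o r"
proof -
  have one: "|{{}}| \<le>o r"
    using r by (intro countable_card_of_le) simp_all
  have "|{T. finite T \<and> T \<subseteq> A \<and> card T = n}| \<le>o r" for n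
  proof (induction n)
    case 0
    have "{T. finite T \<and> T \<subseteq> A \<and> card T = 0} = {{}}" by auto
    then show ?case using one by simp
  next
    case (Suc n)
    let ?P = "{T. finite T \<and> T \<subseteq> A \<and> card T = n}"
    have "{T. finite T \<and> T \<subseteq> A \<and> card T = Suc n} \<subseteq> (\<Union>a\<in>A. insert a ` ?P)"
      by (auto simp: card_Suc_eq)
    moreover have "|\<Union>a\<in>A. insert a ` ?P| \<le>o r"
      using r A card_of_image_le[OF Suc] by (intro UNION_Cinfinite_bound ballI)
    ultimately show ?case
      by (rule ordLeq_transitive[OF card_of_mono1])
  qed
  moreover have "|UNIV :: nat set| \<le>o r"
    using r card_of_nat natLeq_ordLeq_cinfinite ordIso_ordLeq_trans by blast
  moreover have "{T. finite T \<and> T \<subseteq> A} = (\<Union>n. {T. finite T \<and> T \<subseteq> A \<and> card T = n})"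
    by auto
  ultimately show ?thesis
    using r by (simp only:) (intro UNION_Cinfinite_bound ballI)
qed

lemma Cinfinite_network_weight: "Cinfinite (network_weight X)"
  unfolding network_weight_def by (rule Cinfinite_csum) (simp add: natLeq_Cinfinite)

text \<open>An infinite \<open>r\<close> absorbs the summand \<open>natLeq\<close> in the definition
  of the network weight.\<close>

lemma network_weight_le:
  assumes "is_network X \<N>" "|\<N>| \<le>o r" "Cinfinite r"
  shows "network_weight X \<le>o r"
proof -
  let ?S = "SOME \<N>. is_minimal_network X \<N>"
  have "is_minimal_network X ?S"
    using is_minimal_network_exists by (rule someI_ex)
  then have "|?S| \<le>o r"
    using assms(1,2) ordLeq_transitive unfolding is_minimal_network_def by blast
  then show ?thesis
    unfolding network_weight_def using assms(3)
    by (intro csum_cinfinite_bound) (auto simp: natLeq_Card_order natLeq_ordLeq_cinfinite card_of_Card_order)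
qed

lemma network_weight_witness:
  obtains \<N> where "is_network X \<N>" "|\<N>| \<le>o network_weight X"
proof -
  let ?S = "SOME \<N>. is_minimal_network X \<N>"
  have "is_minimal_network X ?S"
    using is_minimal_network_exists by (rule someI_ex)
  moreover have "|?S| \<le>o network_weight X"
    unfolding network_weight_def by (rule ordLeq_csum2) (rule card_of_Card_order)
  ultimately show ?thesis
    using that unfolding is_minimal_network_def by blast
qed

section \<open>Pointwise series and continuity relative to a subset\<close>

lemma sums_fun_iff:
  fixes g :: "nat \<Rightarrow> 'a \<Rightarrow> 'b::{comm_monoid_add,topological_space}"
  shows "g sums c \<longleftrightarrow> (\<forall>x. (\<lambda>n. g n x) sums c x)"
proof -
  have "(\<Sum>i<n. g i) x = (\<Sum>i<n. g i x)" for n x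
    by (induction n) auto
  then show ?thesis
    unfolding sums_def
    using limitin_componentwise[of "\<lambda>_. euclidean" UNIV "\<lambda>n. \<Sum>i<n. g i" c sequentially]
    by (simp add: euclidean_product_topology)
qed

text \<open>For \<open>x\<close> in \<open>A\<close> this is continuity at \<open>x\<close> of the
  restriction of \<open>f\<close> to \<open>A\<close>. In the epsilon form its negation supplies a
  jump of definite size, and such sizes are what the series argument compares.\<close>

definition continuous_rel :: "'a topology \<Rightarrow> 'a set \<Rightarrow> ('a \<Rightarrow> real) \<Rightarrow> 'a \<Rightarrow> bool" where
  "continuous_rel X A f x \<longleftrightarrow>
     (\<forall>e>0. \<exists>U. openin X U \<and> x \<in> U \<and> (\<forall>y\<in>U \<inter> A. \<bar>f y - f x\<bar> < e))"

lemma topcontinuous_at_imp_continuous_rel: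
  assumes "topcontinuous_at (subtopology X A) euclideanreal f x"
  shows "continuous_rel X A f x"
  unfolding continuous_rel_def
proof (intro allI impI)
  fix e :: real assume "e > 0"
  then have "openin euclideanreal (ball (f x) e)" "f x \<in> ball (f x) e" by auto
  then obtain U where U: "openin (subtopology X A) U" "x \<in> U" "\<forall>y\<in>U. f y \<in> ball (f x) e"
    using assms unfolding topcontinuous_at_def by blast
  then obtain T where "openin X T" "U = T \<inter> A"
    by (auto simp: openin_subtopology)
  then show "\<exists>U. openin X U \<and> x \<in> U \<and> (\<forall>y\<in>U \<inter> A. \<bar>f y - f x\<bar> < e)"
    using U by (intro exI[of _ T]) (auto simp: dist_real_def abs_minus_commute)
qed

lemma continuous_rel_diff:
  assumes "continuous_rel X A f x" "continuous_rel X A g x"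
  shows "continuous_rel X A (\<lambda>y. f y - g y) x"
  unfolding continuous_rel_def
proof (intro allI impI)
  fix e :: real assume "e > 0"
  then have e: "e / 2 > 0" by simp
  obtain U where U: "openin X U" "x \<in> U" "\<forall>y\<in>U \<inter> A. \<bar>f y - f x\<bar> < e/2"
    using assms(1) e unfolding continuous_rel_def by blast
  obtain V where V: "openin X V" "x \<in> V" "\<forall>y\<in>V \<inter> A. \<bar>g y - g x\<bar> < e/2"
    using assms(2) e unfolding continuous_rel_def by blast
  have "\<bar>f y - g y - (f x - g x)\<bar> < e" if "y \<in> U \<inter> V \<inter> A" for y
  proof -
    have "\<bar>f y - f x\<bar> < e/2" "\<bar>g y - g x\<bar> < e/2" using that U V by auto
    then show ?thesis by linarith
  qed
  then show "\<exists>U. openin X U \<and> x \<in> U \<and> (\<forall>y\<in>U \<inter> A. \<bar>f y - g y - (f x - g x)\<bar> < e)"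
    using U V by (intro exI[of _ "U \<inter> V"]) auto
qed

lemma continuous_rel_cmult:
  assumes "continuous_rel X A f x" "(c::real) > 0"
  shows "continuous_rel X A (\<lambda>y. c * f y) x"
  unfolding continuous_rel_def
proof (intro allI impI)
  fix e :: real assume "e > 0"
  then have e: "e / c > 0" using assms(2) by simp
  obtain U where U: "openin X U" "x \<in> U" "\<forall>y\<in>U \<inter> A. \<bar>f y - f x\<bar> < e/c"
    using assms(1) e unfolding continuous_rel_def by blast
  have "\<bar>c * f y - c * f x\<bar> < e" if "y \<in> U \<inter> A" for y
  proof -
    have "\<bar>c * f y - c * f x\<bar> = c * \<bar>f y - f x\<bar>"
      using assms(2) by (simp add: abs_mult flip: right_diff_distrib)
    also have "\<dots> < c * (e / c)" using U(3) that assms(2) by (intro mult_strict_left_mono) auto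
    finally show ?thesis using assms(2) by simp
  qed
  then show "\<exists>U. openin X U \<and> x \<in> U \<and> (\<forall>y\<in>U \<inter> A. \<bar>c * f y - c * f x\<bar> < e)"
    using U by blast
qed

section \<open>Boundedness of \<sigma>-convex sets and discontinuities of their combinations\<close>

text \<open>If the values at \<open>x\<close> were unbounded, members growing faster than
  \<open>2 ^ Suc n\<close> at \<open>x\<close>, combined with the weights
  \<open>(1/2) ^ Suc n\<close>, would give a series whose terms do not tend to 0 at
  \<open>x\<close>.\<close>

lemma sigma_convex_pointwise_bounded:
  fixes \<F> :: "('a \<Rightarrow> real) set"
  assumes "sigma_convex \<F>"
  shows "\<exists>M. \<forall>f\<in>\<F>. \<bar>f x\<bar> \<le> M"
proof (rule ccontr)
  assume "\<not> ?thesis"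
  then have "\<exists>f\<in>\<F>. \<bar>f x\<bar> > 2 ^ Suc n" for n :: nat
    by (meson not_le)
  then obtain g where g: "\<And>n. g n \<in> \<F>" "\<And>n. \<bar>g n x\<bar> > 2 ^ Suc n"
    by metis
  let ?t = "\<lambda>n. (1/2::real) ^ Suc n"
  obtain c where "(\<lambda>n. ?t n *\<^sub>R g n) sums c"
    using assms g(1) power_half_series unfolding sigma_convex_def
    by (metis half_gt_zero_iff zero_less_one zero_less_power)
  then have "(\<lambda>n. ?t n * g n x) sums c x"
    by (simp add: sums_fun_iff)
  then have lim: "(\<lambda>n. ?t n * g n x) \<longlonglongrightarrow> 0"
    using summable_LIMSEQ_zero sums_summable by blast
  have ge: "\<bar>?t n * g n x\<bar> \<ge> 1" for n
    using g(2)[of n] by (simp add: abs_mult field_simps)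
  obtain N where "\<forall>n\<ge>N. norm (?t n * g n x - 0) < 1"
    using LIMSEQ_D[OF lim, of 1] by auto
  then have "\<bar>?t N * g N x\<bar> < 1" by (metis diff_zero order_refl real_norm_def)
  with ge[of N] show False by linarith
qed

text \<open>A closing-off argument: iterating \<open>b\<close> from \<open>a\<close> and taking the
  union over all stages. It serves to find the countable witnesses given by tightness inside one
  countable set.\<close>

lemma countable_subset_closed_under:
  assumes "\<And>x. x \<in> A \<Longrightarrow> countable (b x) \<and> b x \<subseteq> A" "a \<in> A"
  shows "\<exists>Q. countable Q \<and> a \<in> Q \<and> Q \<subseteq> A \<and> (\<forall>x\<in>Q. b x \<subseteq> Q)"
proof -
  define q where "q n = ((\<lambda>S. S \<union> (\<Union>x\<in>S. b x)) ^^ n) {a}" for n :: nat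
  have q0: "q 0 = {a}" and qS: "q (Suc n) = q n \<union> (\<Union>x\<in>q n. b x)" for n
    by (simp_all add: q_def)
  have q: "countable (q n) \<and> q n \<subseteq> A" for n
  proof (induction n)
    case (Suc n)
    then have "\<And>x. x \<in> q n \<Longrightarrow> countable (b x) \<and> b x \<subseteq> A" using assms(1) by blast
    with Suc show ?case unfolding qS by auto
  qed (use assms(2) in \<open>simp add: q0\<close>)
  have "b x \<subseteq> (\<Union>n. q n)" if "x \<in> q n" for x n
    using that qS[of n] by blast
  moreover have "a \<in> (\<Union>n. q n)" using q0 by blast
  moreover have "countable (\<Union>n. q n)" "(\<Union>n. q n) \<subseteq> A"
    using q by auto
  ultimately show ?thesis by (intro exI[of _ "\<Union>n. q n"]) blast
qed

lemma not_continuous_rel_iff: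
  "\<not> continuous_rel X A f x \<longleftrightarrow>
     (\<exists>e>0. \<forall>U. openin X U \<and> x \<in> U \<longrightarrow> (\<exists>y\<in>U \<inter> A. e \<le> \<bar>f y - f x\<bar>))"
  unfolding continuous_rel_def by (meson not_less)

text \<open>
  The weights are chosen one at a time. Of the two candidates \<open>r\<close> and \<open>r / 2\<close> for the weight of
  \<open>h k\<close> at least one makes the partial sum discontinuous at \<open>x k\<close>; the remaining weights
  are then kept so small that, the functions being uniformly bounded, they cannot repair
  the jump.
\<close>

lemma discontinuous_series:
  fixes h :: "nat \<Rightarrow> 'a \<Rightarrow> real"
  assumes disc: "\<And>k. \<not> continuous_rel X Q (h k) (x k)"
    and x: "\<And>k. x k \<in> Q" and M: "M > 0" "\<And>k y. y \<in> Q \<Longrightarrow> \<bar>h k y\<bar> \<le> M"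
  obtains c where "\<And>k. c k > 0" "summable c"
    "\<And>k. \<not> continuous_rel X Q (\<lambda>y. \<Sum>n. c n * h n y) (x k)"
proof -
  define jump where "jump g z e \<longleftrightarrow>
      (\<forall>U. openin X U \<and> z \<in> U \<longrightarrow> (\<exists>y\<in>U \<inter> Q. e \<le> \<bar>g y - g z\<bar>))" for g :: "'a \<Rightarrow> real" and z e
  have jump_iff: "\<not> continuous_rel X Q g z \<longleftrightarrow> (\<exists>e>0. jump g z e)" for g z
    unfolding not_continuous_rel_iff jump_def ..
  \<comment> \<open>Here \<open>s\<close> is the budget for the later weights. They will sum to at
    most \<open>2 * s\<close>, so they move each value by at most \<open>2 * M * s\<close> and
    reduce a jump by at most \<open>4 * M * s\<close>, half of \<open>8 * M * s\<close>.\<close>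
  have step: "\<exists>c s. 0 < c \<and> c \<le> r \<and> 0 < s \<and> s \<le> r / 2 \<and>
      jump (\<lambda>y. g y + c * h k y) (x k) (8 * M * s)" if "r > 0" for g r k
  proof -
    have "\<exists>c. 0 < c \<and> c \<le> r \<and> \<not> continuous_rel X Q (\<lambda>y. g y + c * h k y) (x k)"
    proof (rule ccontr)
      assume "\<not> ?thesis"
      then have *: "\<And>c. 0 < c \<Longrightarrow> c \<le> r \<Longrightarrow> continuous_rel X Q (\<lambda>y. g y + c * h k y) (x k)"
        by blast
      have "continuous_rel X Q (\<lambda>y. 2 / r * (g y + r * h k y - (g y + r / 2 * h k y))) (x k)"
        using \<open>r > 0\<close> by (intro continuous_rel_cmult continuous_rel_diff *) auto
      moreover have "(\<lambda>y. 2 / r * (g y + r * h k y - (g y + r / 2 * h k y))) = h k"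
        using \<open>r > 0\<close> by (simp add: fun_eq_iff field_simps)
      ultimately show False using disc[of k] by (simp only: not_True_eq_False)
    qed
    then obtain c e where c: "0 < c" "c \<le> r" and e: "e > 0" "jump (\<lambda>y. g y + c * h k y) (x k) e"
      unfolding jump_iff by blast
    \<comment> \<open>The first bound halves the budget at every stage, which makes the tails
      geometric; the second keeps \<open>8 * M * s\<close> below the jump \<open>e\<close>.\<close>
    define s where "s = min (r / 2) (e / (8 * M))"
    have "8 * M * s \<le> e"
      using M(1) by (simp add: s_def min_def field_simps)
    then have "jump (\<lambda>y. g y + c * h k y) (x k) (8 * M * s)"
      using e(2) unfolding jump_def by (meson order_trans)
    moreover have "0 < s" "s \<le> r / 2" using \<open>r > 0\<close> e(1) M(1) by (simp_all add: s_def)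
    ultimately show ?thesis using c by blast
  qed
  \<comment> \<open>A state consists of the partial sum up to \<open>k\<close>, its last weight and
    the budget for the weights after it.\<close>
  let ?P = "\<lambda>k (g, c, r). (0::real) < c \<and> 0 < r \<and> jump g (x k) (8 * M * r)"
  let ?R = "\<lambda>k (g, c, r) (g', c', r'). c' \<le> r \<and> r' \<le> r / 2 \<and> g' = (\<lambda>y. g y + c' * h (Suc k) y)"
  obtain c0 s0 where 0: "0 < c0" "0 < s0" "jump (\<lambda>y. c0 * h 0 y) (x 0) (8 * M * s0)"
    using step[of 1 "\<lambda>y. 0" 0] by auto
  define w0 where "w0 = (\<lambda>y. c0 * h 0 y, c0, s0)"
  \<comment> \<open>Fixing the state at 0 ensures that \<open>g k\<close> is the full partial sum,
    including the term with index 0.\<close>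
  have "\<exists>w. \<forall>k. (?P k (w k) \<and> (k = 0 \<longrightarrow> w k = w0)) \<and> ?R k (w k) (w (Suc k))"
  proof (rule dependent_nat_choice)
    show "\<exists>v. ?P 0 v \<and> (0 = (0::nat) \<longrightarrow> v = w0)"
      using 0 by (intro exI[of _ w0]) (simp add: w0_def)
  next
    fix v k assume v: "?P k v \<and> (k = 0 \<longrightarrow> v = w0)"
    obtain g c r where v_eq: "v = (g, c, r)" by (cases v)
    with v have "r > 0" by simp
    then obtain c' r' where "0 < c'" "c' \<le> r" "0 < r'" "r' \<le> r / 2"
      "jump (\<lambda>y. g y + c' * h (Suc k) y) (x (Suc k)) (8 * M * r')"
      using step by blast
    then show "\<exists>v'. (?P (Suc k) v' \<and> (Suc k = 0 \<longrightarrow> v' = w0)) \<and> ?R k v v'"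
      by (intro exI[of _ "(\<lambda>y. g y + c' * h (Suc k) y, c', r')"]) (simp add: v_eq)
  qed
  then obtain w where w: "\<forall>k. (?P k (w k) \<and> (k = 0 \<longrightarrow> w k = w0)) \<and> ?R k (w k) (w (Suc k))" ..
  then have w_0: "w 0 = w0" by blast
  define g c r where "g k = fst (w k)" and "c k = fst (snd (w k))" and "r k = snd (snd (w k))" for k
  have c: "0 < c k" and r: "0 < r k" and jump: "jump (g k) (x k) (8 * M * r k)"
    and cS: "c (Suc k) \<le> r k" and rS: "r (Suc k) \<le> r k / 2"
    and gS: "g (Suc k) = (\<lambda>y. g k y + c (Suc k) * h (Suc k) y)" for k
    using spec[OF w, of k] by (simp_all add: g_def c_def r_def case_prod_beta)
  have g: "g k y = (\<Sum>n\<le>k. c n * h n y)" for k y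
    by (induction k) (simp_all add: gS, simp add: g_def c_def w_0 w0_def)
  have rk: "r (n + k) \<le> r k * (1/2) ^ n" for n k
  proof (induction n)
    case (Suc n)
    then show ?case using rS[of "n + k"] by simp
  qed simp
  have ck: "c (n + Suc k) \<le> r k * (1/2) ^ n" for n k
    using cS[of "n + k"] rk[of n k] by simp
  have geo: "summable (\<lambda>n. r k * (1/2::real) ^ n)" "(\<Sum>n. r k * (1/2::real) ^ n) = 2 * r k" for k
    by (simp_all add: summable_mult suminf_mult suminf_geometric)
  have sum_tail: "summable (\<lambda>n. c (n + Suc k))" for k
    by (rule summable_comparison_test'[OF geo(1)[of k], of 0]) (use ck c in \<open>simp add: less_imp_le\<close>)
  then have c_sum: "summable c" using summable_iff_shift by blast
  have tail: "(\<Sum>n. c (n + Suc k)) \<le> 2 * r k" for k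
    unfolding geo(2)[symmetric] by (rule suminf_le[OF ck sum_tail geo(1)])
  have h_sum: "summable (\<lambda>n. c n * h n y)" if "y \<in> Q" for y
  proof (rule summable_comparison_test'[of "\<lambda>n. c n * M" 0])
    show "summable (\<lambda>n. c n * M)" using c_sum by (rule summable_mult2)
    show "norm (c n * h n y) \<le> c n * M" for n
      using M(2)[OF that, of n] c[of n] by (simp add: abs_mult mult_left_mono)
  qed
  let ?f = "\<lambda>y. \<Sum>n. c n * h n y"
  have approx: "\<bar>?f y - g k y\<bar> \<le> 2 * M * r k" if "y \<in> Q" for y k
  proof -
    have "?f y = (\<Sum>n. c (n + Suc k) * h (n + Suc k) y) + g k y"
      using suminf_split_initial_segment[OF h_sum[OF that], of "Suc k"]
      by (simp only: g lessThan_Suc_atMost)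
    moreover have "\<bar>\<Sum>n. c (n + Suc k) * h (n + Suc k) y\<bar> \<le> (\<Sum>n. c (n + Suc k) * M)"
    proof -
      have "norm (\<Sum>n. c (n + Suc k) * h (n + Suc k) y) \<le> (\<Sum>n. c (n + Suc k) * M)"
      proof (rule norm_suminf_le)
        show "norm (c (n + Suc k) * h (n + Suc k) y) \<le> c (n + Suc k) * M" for n
          using M(2)[OF that, of "n + Suc k"] c[of "n + Suc k"] by (simp add: abs_mult mult_left_mono)
        show "summable (\<lambda>n. c (n + Suc k) * M)"
          by (rule summable_mult2[OF sum_tail])
      qed
      then show ?thesis by simp
    qed
    moreover have "(\<Sum>n. c (n + Suc k) * M) \<le> 2 * M * r k"
      using mult_right_mono[OF tail[of k], of M] M(1) suminf_mult2[OF sum_tail[of k], of M]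
      by (simp only: mult_ac less_imp_le)
    ultimately show ?thesis by linarith
  qed
  have "jump ?f (x k) (4 * M * r k)" for k
    unfolding jump_def
  proof (intro allI impI)
    fix U assume "openin X U \<and> x k \<in> U"
    then obtain y where y: "y \<in> U \<inter> Q" "8 * M * r k \<le> \<bar>g k y - g k (x k)\<bar>"
      using jump[of k] unfolding jump_def by blast
    then show "\<exists>y\<in>U \<inter> Q. 4 * M * r k \<le> \<bar>?f y - ?f (x k)\<bar>"
      using approx[of y k] approx[OF x, of k k] by (intro bexI[OF _ y(1)]) auto
  qed
  moreover have "4 * M * r k > 0" for k using M(1) r by simp
  ultimately have "\<not> continuous_rel X Q ?f (x k)" for k
    unfolding jump_iff by blast
  then show ?thesis using that c c_sum by blast
qed

text \<open>
  Suppose that the set \<open>E\<close> of points at which some member of \<open>\<F>\<close> is discontinuous is dense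
  in \<open>A\<close>. Countable tightness reflects this to a countable \<open>Q \<subseteq> A\<close>, and a single
  \<open>\<sigma>\<close>-convex combination \<open>f\<close> is then discontinuous at all points of the dense subset
  \<open>Q \<inter> E\<close> of \<open>Q\<close>. It cannot be continuous on \<open>Q \<inter> E\<close> at any \<open>x\<close>, because at the points of
  \<open>Q - E\<close>, which witness the jump at \<open>x\<close>, it is a limit of values on \<open>Q \<inter> E\<close>.
\<close>

lemma common_continuity:
  assumes tight: "countable_tightness X"
    and F: "\<F> \<subseteq> topspace (SCp X)" "sigma_convex \<F>"
    and A: "A \<subseteq> topspace X" "A \<noteq> {}"
    and bound: "\<And>f x. f \<in> \<F> \<Longrightarrow> x \<in> A \<Longrightarrow> \<bar>f x\<bar> \<le> M"
  shows "\<exists>U. openin X U \<and> U \<inter> A \<noteq> {} \<and> (\<forall>f\<in>\<F>. \<forall>x\<in>U \<inter> A. continuous_rel X A f x)"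
proof (rule ccontr)
  assume contra: "\<not> ?thesis"
  define E where "E = {x \<in> A. \<exists>f\<in>\<F>. \<not> continuous_rel X A f x}"
  have meets: "U \<inter> E \<noteq> {}" if "openin X U" "U \<inter> A \<noteq> {}" for U
    using contra that unfolding E_def by blast
  have AE: "x \<in> X closure_of E" if "x \<in> A" for x
    using that A(1) meets unfolding in_closure_of by blast
  have "\<forall>x\<in>E. \<exists>f e. f \<in> \<F> \<and> e > 0 \<and>
      (\<forall>U. openin X U \<and> x \<in> U \<longrightarrow> (\<exists>y\<in>U \<inter> A. e \<le> \<bar>f y - f x\<bar>))"
    unfolding E_def not_continuous_rel_iff by blast
  then obtain h e where h: "\<And>x. x \<in> E \<Longrightarrow> h x \<in> \<F>" and e: "\<And>x. x \<in> E \<Longrightarrow> e x > 0"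
    and jump: "\<And>x U. x \<in> E \<Longrightarrow> openin X U \<Longrightarrow> x \<in> U \<Longrightarrow> \<exists>y\<in>U \<inter> A. e x \<le> \<bar>h x y - h x x\<bar>"
    by metis
  let ?J = "\<lambda>x. {y \<in> A. e x \<le> \<bar>h x y - h x x\<bar>}"
  \<comment> \<open>Tightness is used twice at each point: once for the density of \<open>E\<close>,
    and, at points of \<open>E\<close>, once more for the set \<open>?J x\<close> of points
    witnessing the jump. A set \<open>Q\<close> closed under \<open>b\<close> then inherits both
    properties.\<close>
  have "\<forall>x\<in>A. \<exists>b. countable b \<and> b \<subseteq> A \<and> x \<in> X closure_of (b \<inter> E) \<and>
      (x \<in> E \<longrightarrow> x \<in> X closure_of (b \<inter> ?J x))"
  proof
    fix x assume x: "x \<in> A"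
    have EA: "E \<subseteq> A" unfolding E_def by blast
    obtain B where B: "B \<subseteq> E" "countable B" "x \<in> X closure_of B"
      using tight AE[OF x] EA A(1) unfolding countable_tightness_iff by (meson subset_trans)
    have "\<exists>C. C \<subseteq> ?J x \<and> countable C \<and> (x \<in> E \<longrightarrow> x \<in> X closure_of C)"
    proof (cases "x \<in> E")
      case True
      have "x \<in> X closure_of ?J x"
        using jump[OF True] x A(1) unfolding in_closure_of by blast
      moreover have "?J x \<subseteq> topspace X" using A(1) by blast
      ultimately show ?thesis
        using tight unfolding countable_tightness_iff by blast
    qed auto
    then obtain C where C: "C \<subseteq> ?J x" "countable C" "x \<in> E \<longrightarrow> x \<in> X closure_of C" by blast
    have "B \<subseteq> (B \<union> C) \<inter> E" "C \<subseteq> (B \<union> C) \<inter> ?J x" using B C by auto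
    then have "x \<in> X closure_of ((B \<union> C) \<inter> E)"
      "x \<in> E \<longrightarrow> x \<in> X closure_of ((B \<union> C) \<inter> ?J x)"
      using B(3) C(3) closure_of_mono by blast+
    moreover have "countable (B \<union> C)" "B \<union> C \<subseteq> A" using B C EA by auto
    ultimately show "\<exists>b. countable b \<and> b \<subseteq> A \<and> x \<in> X closure_of (b \<inter> E) \<and>
      (x \<in> E \<longrightarrow> x \<in> X closure_of (b \<inter> ?J x))" by blast
  qed
  from bchoice[OF this] obtain b where b0: "\<forall>x\<in>A. countable (b x) \<and> b x \<subseteq> A \<and>
      x \<in> X closure_of (b x \<inter> E) \<and> (x \<in> E \<longrightarrow> x \<in> X closure_of (b x \<inter> ?J x))" ..
  have b: "countable (b x) \<and> b x \<subseteq> A" "x \<in> X closure_of (b x \<inter> E)"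
      "x \<in> E \<Longrightarrow> x \<in> X closure_of (b x \<inter> ?J x)" if "x \<in> A" for x
    using bspec[OF b0 that] by simp_all
  obtain a where "a \<in> A" using A(2) by blast
  from countable_subset_closed_under[of A b a, OF b(1) this]
  obtain Q where Q: "countable Q" "a \<in> Q" "Q \<subseteq> A" "\<And>x. x \<in> Q \<Longrightarrow> b x \<subseteq> Q" by blast
  have dense: "\<exists>y\<in>Q \<inter> E. y \<in> U" if "x \<in> Q" "openin X U" "x \<in> U" for x U
    using b(2)[of x] Q(3) Q(4)[of x] that unfolding in_closure_of by blast
  have disc: "\<not> continuous_rel X Q (h x) x" if "x \<in> Q \<inter> E" for x
    unfolding not_continuous_rel_iff
  proof (intro exI[of _ "e x"] conjI allI impI)
    show "e x > 0" using e that by blast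
    fix U assume "openin X U \<and> x \<in> U"
    then show "\<exists>y\<in>U \<inter> Q. e x \<le> \<bar>h x y - h x x\<bar>"
      using b(3)[of x] Q(3) Q(4)[of x] that unfolding in_closure_of by blast
  qed
  have QE: "Q \<inter> E \<noteq> {}"
    using dense[OF Q(2) openin_topspace] Q(2,3) A(1) by blast
  \<comment> \<open>For finite \<open>Q \<inter> E\<close> the enumeration repeats points. This is
    harmless, since only membership and surjectivity matter.\<close>
  define z where "z = from_nat_into (Q \<inter> E)"
  have z_in: "z k \<in> Q \<inter> E" for k
    unfolding z_def by (rule from_nat_into[OF QE])
  have z_surj: "\<exists>k. z k = x" if "x \<in> Q \<inter> E" for x
    unfolding z_def using from_nat_into_surj[OF _ that] Q(1) by blast
  \<comment> \<open>The bound \<open>max 1 M\<close> is taken because \<open>M\<close> is not known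
    to be positive.\<close>
  obtain c where c: "\<And>k. c k > 0" "summable c"
    and disc_sum: "\<And>k. \<not> continuous_rel X Q (\<lambda>y. \<Sum>n. c n * h (z n) y) (z k)"
  proof (rule discontinuous_series[of X Q "\<lambda>k. h (z k)" z "max 1 M"])
    show "\<not> continuous_rel X Q (h (z k)) (z k)" for k using disc z_in by blast
    show "z k \<in> Q" for k using z_in by blast
    show "\<bar>h (z k) y\<bar> \<le> max 1 M" if "y \<in> Q" for k y
      using bound[of "h (z k)" y] h z_in[of k] that Q(3) by (simp add: subset_iff le_max_iff_disj)
  qed auto
  define T where "T = suminf c"
  have T: "T > 0" unfolding T_def using c by (intro suminf_pos) auto
  have "(\<lambda>n. c n / T) sums 1"
    using sums_divide[OF summable_sums[OF c(2)], of T] T by (simp add: T_def)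
  moreover have "\<And>n. c n / T > 0" using c(1) T by simp
  ultimately obtain f where f: "f \<in> \<F>" "(\<lambda>n. (c n / T) *\<^sub>R h (z n)) sums f"
    using F(2)[unfolded sigma_convex_def, rule_format, of "\<lambda>n. h (z n)" "\<lambda>n. c n / T"] h z_in
    by blast
  have "(\<lambda>n. c n * h (z n) y) sums (T * f y)" for y
  proof -
    have "(\<lambda>n. c n / T * h (z n) y) sums f y" using f(2) by (simp add: sums_fun_iff)
    from sums_mult[OF this, of T] show ?thesis using T by simp
  qed
  then have eq: "(\<lambda>y. \<Sum>n. c n * h (z n) y) = (\<lambda>y. T * f y)"
    by (intro ext sums_unique[symmetric])
  have f_disc: "\<not> continuous_rel X Q f x" if "x \<in> Q \<inter> E" for x
  proof
    assume "continuous_rel X Q f x"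
    then have "continuous_rel X Q (\<lambda>y. T * f y) x" using T by (rule continuous_rel_cmult)
    then show False using z_surj[OF that] disc_sum unfolding eq by blast
  qed
  have "scatteredly_continuous X euclideanreal f"
    using f(1) F(1) unfolding SCp_def by auto
  then obtain x where x: "x \<in> Q \<inter> E" and "topcontinuous_at (subtopology X (Q \<inter> E)) euclideanreal f x"
    using QE Q(3) A(1) unfolding scatteredly_continuous_def by (meson inf.coboundedI1 subset_trans)
  then have cont: "continuous_rel X (Q \<inter> E) f x"
    by (simp add: topcontinuous_at_imp_continuous_rel)
  obtain d where d: "d > 0"
    and jump_f: "\<And>U. openin X U \<Longrightarrow> x \<in> U \<Longrightarrow> \<exists>y\<in>U \<inter> Q. d \<le> \<bar>f y - f x\<bar>"
    using f_disc[OF x] unfolding not_continuous_rel_iff by blast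
  have d3: "d / 3 > 0" using d by simp
  obtain U where U: "openin X U" "x \<in> U" "\<forall>y\<in>U \<inter> (Q \<inter> E). \<bar>f y - f x\<bar> < d / 3"
    using cont d3 unfolding continuous_rel_def by blast
  obtain y where y: "y \<in> U" "y \<in> Q" "d \<le> \<bar>f y - f x\<bar>"
    using jump_f[OF U(1,2)] by blast
  then have "y \<notin> E" using U(3) d by force
  then have "continuous_rel X A f y"
    using f(1) y(2) Q(3) unfolding E_def by blast
  then obtain V where V: "openin X V" "y \<in> V" "\<forall>w\<in>V \<inter> A. \<bar>f w - f y\<bar> < d / 3"
    using d3 unfolding continuous_rel_def by blast
  \<comment> \<open>By density of \<open>Q \<inter> E\<close> in \<open>Q\<close> some
    \<open>w\<close> is close to both points: \<open>f w\<close> is within \<open>d / 3\<close> of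
    \<open>f x\<close> and of \<open>f y\<close>, against the jump \<open>d\<close> between these
    two values.\<close>
  obtain w where w: "w \<in> Q \<inter> E" "w \<in> U \<inter> V"
    using dense[OF y(2), of "U \<inter> V"] U(1) V(1,2) y(1) by blast
  then have "\<bar>f w - f x\<bar> < d / 3" "\<bar>f w - f y\<bar> < d / 3"
    using U(3) V(3) Q(3) by auto
  then show False using y(3) by linarith
qed

section \<open>Small families of sets controlling the values of all members of \<F>\<close>

text \<open>Only one function is controlled at a time; finitely many conditions are combined later,
  in the function space. The members of \<open>\<S>\<close> may leave \<open>A\<close>, so that a
  family for \<open>A\<close> also serves every subset of \<open>A\<close>.\<close>

definition value_network :: "('a \<Rightarrow> real) set \<Rightarrow> 'a set \<Rightarrow> 'a set set \<Rightarrow> bool" where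
  "value_network \<F> A \<S> \<longleftrightarrow>
     (\<forall>x\<in>A. \<forall>f\<in>\<F>. \<forall>e>0. \<exists>S\<in>\<S>. x \<in> S \<and> (\<forall>y\<in>S. \<bar>f y - f x\<bar> < e))"

lemma value_network_UN:
  assumes "\<And>i. i \<in> I \<Longrightarrow> value_network \<F> (A i) (\<S> i)"
  shows "value_network \<F> (\<Union>i\<in>I. A i) (\<Union>i\<in>I. \<S> i)"
  unfolding value_network_def
proof (intro ballI allI impI)
  fix x f and e :: real
  assume "x \<in> (\<Union>i\<in>I. A i)" "f \<in> \<F>" "e > 0"
  then obtain i where "i \<in> I" "x \<in> A i" by blast
  with assms[of i] \<open>f \<in> \<F>\<close> \<open>e > 0\<close> obtain S where "S \<in> \<S> i" "x \<in> S" "\<forall>y\<in>S. \<bar>f y - f x\<bar> < e"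
    unfolding value_network_def by blast
  with \<open>i \<in> I\<close> show "\<exists>S\<in>(\<Union>i\<in>I. \<S> i). x \<in> S \<and> (\<forall>y\<in>S. \<bar>f y - f x\<bar> < e)"
    by blast
qed

lemma value_network_Un:
  "value_network \<F> A \<S> \<Longrightarrow> value_network \<F> B \<T> \<Longrightarrow> value_network \<F> (A \<union> B) (\<S> \<union> \<T>)"
  using value_network_UN[of "UNIV :: bool set" \<F> "\<lambda>c. if c then A else B" "\<lambda>c. if c then \<S> else \<T>"]
  by (simp add: UNIV_bool Un_commute)

lemma value_network_mono:
  "value_network \<F> A \<S> \<Longrightarrow> B \<subseteq> A \<Longrightarrow> value_network \<F> B \<S>"
  unfolding value_network_def by blast

text \<open>An exhaustion argument: the union \<open>G\<close> of all open sets over which a small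
  family exists has such a family itself. If \<open>B - G\<close> were nonempty, common continuity
  on a relatively open part of it would enlarge \<open>G\<close>.\<close>

lemma value_network_bounded:
  assumes "countable_tightness X" "\<F> \<subseteq> topspace (SCp X)" "sigma_convex \<F>"
    and B: "B \<subseteq> topspace X" "\<And>f x. f \<in> \<F> \<Longrightarrow> x \<in> B \<Longrightarrow> \<bar>f x\<bar> \<le> M"
    and N: "is_network X \<N>" "|\<N>| \<le>o r" "Cinfinite r"
  shows "\<exists>\<S>. |\<S>| \<le>o r \<and> value_network \<F> B \<S>"
proof -
  define nice where "nice U \<longleftrightarrow> openin X U \<and> (\<exists>\<S>. |\<S>| \<le>o r \<and> value_network \<F> (U \<inter> B) \<S>)" for U
  define G where "G = \<Union>{U. nice U}"
  have G_open: "openin X G"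
    unfolding G_def nice_def by auto
  \<comment> \<open>Written as a union of network members, \<open>G\<close> needs at most
    \<open>r\<close> pieces, however many nice sets there are.\<close>
  have G_eq: "G = \<Union>{N \<in> \<N>. \<exists>U. nice U \<and> N \<subseteq> U}"
  proof
    show "G \<subseteq> \<Union>{N \<in> \<N>. \<exists>U. nice U \<and> N \<subseteq> U}"
    proof
      fix x assume "x \<in> G"
      then obtain U where U: "nice U" "x \<in> U" unfolding G_def by blast
      then have "openin X U" by (simp add: nice_def)
      with U(2) N(1) obtain N where "N \<in> \<N>" "x \<in> N" "N \<subseteq> U"
        unfolding is_network_def by blast
      with U(1) show "x \<in> \<Union>{N \<in> \<N>. \<exists>U. nice U \<and> N \<subseteq> U}" by blast
    qed
    show "\<Union>{N \<in> \<N>. \<exists>U. nice U \<and> N \<subseteq> U} \<subseteq> G"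
      unfolding G_def by blast
  qed
  have G_net: "\<exists>\<S>. |\<S>| \<le>o r \<and> value_network \<F> (G \<inter> B) \<S>"
  proof -
    let ?I = "{N \<in> \<N>. \<exists>U. nice U \<and> N \<subseteq> U}"
    have "\<forall>N\<in>?I. \<exists>\<S>. |\<S>| \<le>o r \<and> value_network \<F> (N \<inter> B) \<S>"
    proof
      fix N assume "N \<in> ?I"
      then obtain U where "nice U" "N \<inter> B \<subseteq> U \<inter> B" by blast
      then obtain \<S> where "|\<S>| \<le>o r" "value_network \<F> (U \<inter> B) \<S>"
        unfolding nice_def by blast
      with value_network_mono[OF this(2) \<open>N \<inter> B \<subseteq> U \<inter> B\<close>]
      show "\<exists>\<S>. |\<S>| \<le>o r \<and> value_network \<F> (N \<inter> B) \<S>" by blast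
    qed
    from bchoice[OF this] obtain \<S> where S:
      "\<forall>N\<in>?I. |\<S> N| \<le>o r \<and> value_network \<F> (N \<inter> B) (\<S> N)" ..
    have "?I \<subseteq> \<N>" by blast
    then have "|?I| \<le>o r"
      using N(2) by (rule ordLeq_transitive[OF card_of_mono1])
    then have "|\<Union>N\<in>?I. \<S> N| \<le>o r"
      using S N(3) by (intro UNION_Cinfinite_bound) simp_all
    moreover have "value_network \<F> (\<Union>N\<in>?I. N \<inter> B) (\<Union>N\<in>?I. \<S> N)"
      using S by (intro value_network_UN) simp
    moreover have "(\<Union>N\<in>?I. N \<inter> B) = G \<inter> B" unfolding G_eq by blast
    ultimately show ?thesis by (intro exI[of _ "\<Union>N\<in>?I. \<S> N"]) simp
  qed
  have "B \<subseteq> G"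
  proof (rule ccontr)
    assume "\<not> B \<subseteq> G"
    then have "B - G \<noteq> {}" "B - G \<subseteq> topspace X" using B(1) by auto
    then have "\<exists>U. openin X U \<and> U \<inter> (B - G) \<noteq> {} \<and> (\<forall>f\<in>\<F>. \<forall>x\<in>U \<inter> (B - G). continuous_rel X (B - G) f x)"
      using B(2) by (intro common_continuity[OF assms(1-3)]) auto
    then obtain U where U: "openin X U" "U \<inter> (B - G) \<noteq> {}"
      and cont: "\<forall>f\<in>\<F>. \<forall>x\<in>U \<inter> (B - G). continuous_rel X (B - G) f x"
      by blast
    let ?\<T> = "(\<lambda>N. N \<inter> (B - G)) ` \<N>"
    have "value_network \<F> (U \<inter> (B - G)) ?\<T>"
      unfolding value_network_def
    proof (intro ballI allI impI)
      fix x f and e :: real assume x: "x \<in> U \<inter> (B - G)" and "f \<in> \<F>" "e > 0"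
      then have "continuous_rel X (B - G) f x" using cont by blast
      with \<open>e > 0\<close> obtain V where V: "openin X V" "x \<in> V" "\<forall>y\<in>V \<inter> (B - G). \<bar>f y - f x\<bar> < e"
        unfolding continuous_rel_def by blast
      then obtain N where "N \<in> \<N>" "x \<in> N" "N \<subseteq> V"
        using N(1) unfolding is_network_def by blast
      then show "\<exists>S\<in>?\<T>. x \<in> S \<and> (\<forall>y\<in>S. \<bar>f y - f x\<bar> < e)"
        using V x by (intro bexI[of _ "N \<inter> (B - G)"]) auto
    qed
    moreover obtain \<S> where S: "|\<S>| \<le>o r" "value_network \<F> (G \<inter> B) \<S>" using G_net by blast
    \<comment> \<open>The traces of \<open>\<N>\<close> on \<open>B - G\<close> control only the
      part of \<open>U \<inter> B\<close> outside \<open>G\<close>, where continuity relative to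
      \<open>B - G\<close> is available; \<open>\<S>\<close> takes care of the part inside
      \<open>G\<close>.\<close>
    ultimately have "value_network \<F> ((G \<inter> B) \<union> (U \<inter> (B - G))) (\<S> \<union> ?\<T>)"
      by (intro value_network_Un)
    then have "value_network \<F> ((G \<union> U) \<inter> B) (\<S> \<union> ?\<T>)"
      by (rule value_network_mono) blast
    moreover have "|\<S> \<union> ?\<T>| \<le>o r"
      using S(1) card_of_image_le[OF N(2)] N(3) by (intro card_of_Un_ordLeq_infinite_Field) (auto simp: cinfinite_def)
    ultimately have "nice (G \<union> U)"
      unfolding nice_def using openin_Un[OF G_open U(1)] by blast
    then have "U \<subseteq> G" unfolding G_def by blast
    then show False using U(2) by blast
  qed
  then show ?thesis using G_net by (simp add: Int_absorb1)
qed

lemma value_network_exists: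
  assumes "countable_tightness X" "\<F> \<subseteq> topspace (SCp X)" "sigma_convex \<F>"
    and N: "is_network X \<N>" "|\<N>| \<le>o r" "Cinfinite r"
  shows "\<exists>\<S>. |\<S>| \<le>o r \<and> value_network \<F> (topspace X) \<S>"
proof -
  let ?B = "\<lambda>n::nat. {x \<in> topspace X. \<forall>f\<in>\<F>. \<bar>f x\<bar> \<le> real n}"
  have "\<forall>n. \<exists>\<S>. |\<S>| \<le>o r \<and> value_network \<F> (?B n) \<S>"
    by (intro allI value_network_bounded[OF assms(1-3) _ _ N]) auto
  from choice[OF this] obtain \<S> where
    S: "\<forall>n. |\<S> n| \<le>o r \<and> value_network \<F> (?B n) (\<S> n)" ..
  have "|\<Union>n. \<S> n| \<le>o r"
    using S N(3) by (intro UNION_Cinfinite_bound) (simp_all add: countable_card_of_le)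
  moreover have "value_network \<F> (\<Union>n. ?B n) (\<Union>n. \<S> n)"
    using S by (intro value_network_UN) simp
  \<comment> \<open>This is where pointwise boundedness enters: every point has some natural number
    as a bound for all members of \<open>\<F>\<close>.\<close>
  moreover have "topspace X \<subseteq> (\<Union>n. ?B n)"
  proof
    fix x assume "x \<in> topspace X"
    moreover obtain M where "\<forall>f\<in>\<F>. \<bar>f x\<bar> \<le> M"
      using sigma_convex_pointwise_bounded[OF assms(3)] by blast
    moreover obtain n :: nat where "M \<le> real n" using real_arch_simple by blast
    ultimately have "x \<in> ?B n" by (auto intro: order_trans)
    then show "x \<in> (\<Union>n. ?B n)" by blast
  qed
  ultimately show ?thesis using value_network_mono by blast
qed

section \<open>From value networks to networks of function sets\<close>

text \<open>A basic neighbourhood of \<open>f\<close> constrains finitely many coordinates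
  \<open>i\<close>. Each constraint follows from mapping some \<open>S\<close> that contains
  \<open>i\<close> into a rational interval, and there are at most \<open>r\<close> conditions of
  this kind.\<close>

lemma network_of_value_network:
  assumes zero: "\<And>f x. f \<in> \<F> \<Longrightarrow> x \<notin> T \<Longrightarrow> f x = 0"
    and S: "value_network \<F> T \<S>" "|\<S>| \<le>o r" and r: "Cinfinite r"
  shows "\<exists>\<N>. is_network (subtopology euclidean \<F>) \<N> \<and> |\<N>| \<le>o r"
proof -
  define W where "W = (\<lambda>(S, p, q). {f \<in> \<F>. \<forall>y\<in>S. p < f y \<and> f y < q})"
  let ?A = "W ` (\<S> \<times> \<rat> \<times> \<rat>)"
  \<comment> \<open>The intersection with \<open>\<F>\<close> gives the empty family of conditions
    the value \<open>\<F>\<close> instead of the whole type.\<close>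
  let ?N = "(\<lambda>\<A>. \<F> \<inter> \<Inter>\<A>) ` {\<A>. finite \<A> \<and> \<A> \<subseteq> ?A}"
  have "|\<rat> \<times> \<rat> :: (real \<times> real) set| \<le>o r"
    by (intro countable_card_of_le r countable_SIGMA countable_rat)
  then have "|\<S> \<times> (\<rat> \<times> \<rat> :: (real \<times> real) set)| \<le>o r"
    using r by (intro card_of_Times_ordLeq_infinite_Field[OF _ S(2)]) (auto simp: cinfinite_def)
  then have "|?N| \<le>o r"
    by (intro card_of_image_le card_of_finite_subsets r)
  moreover have "is_network (subtopology euclidean \<F>) ?N"
    unfolding is_network_def
  proof (intro conjI allI impI)
    show "?N \<subseteq> Pow (topspace (subtopology euclidean \<F>))" by auto
  next
    fix U f assume "openin (subtopology euclidean \<F>) U \<and> f \<in> U"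
    then obtain V where V: "open V" "U = \<F> \<inter> V" "f \<in> \<F>" "f \<in> V"
      by (auto simp: openin_open)
    obtain Z where Z: "f \<in> PiE UNIV Z" "\<And>i. open (Z i)" "finite {i. Z i \<noteq> UNIV}" "PiE UNIV Z \<subseteq> V"
      using product_topology_open_contains_basis[of "\<lambda>_. euclideanreal" UNIV V f] V(1,4)
      unfolding open_fun_def by auto
    \<comment> \<open>Coordinates outside \<open>T\<close> impose nothing, because all members of
      \<open>\<F>\<close> vanish there and so agree with \<open>f\<close>.\<close>
    let ?J = "{i \<in> T. Z i \<noteq> UNIV}"
    have "\<exists>S p q. S \<in> \<S> \<and> p \<in> \<rat> \<and> q \<in> \<rat> \<and> i \<in> S \<and> (\<forall>y\<in>S. p < f y \<and> f y < q) \<and> {p<..<q} \<subseteq> Z i"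
      if i: "i \<in> T" for i
    proof -
      have "f i \<in> Z i" using Z(1) by auto
      then obtain e where e: "e > 0" "ball (f i) e \<subseteq> Z i"
        using Z(2) open_contains_ball by blast
      obtain p where p: "p \<in> \<rat>" "f i - e < p" "p < f i"
        using Rats_dense_in_real[of "f i - e" "f i"] e(1) by auto
      obtain q where q: "q \<in> \<rat>" "f i < q" "q < f i + e"
        using Rats_dense_in_real[of "f i" "f i + e"] e(1) by auto
      have "min (f i - p) (q - f i) > 0" using p q by simp
      then obtain S where S': "S \<in> \<S>" "i \<in> S" "\<forall>y\<in>S. \<bar>f y - f i\<bar> < min (f i - p) (q - f i)"
        using S(1) i V(3) unfolding value_network_def by blast
      have "\<forall>y\<in>S. p < f y \<and> f y < q"
      proof
        fix y assume "y \<in> S"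
        then have "\<bar>f y - f i\<bar> < f i - p" "\<bar>f y - f i\<bar> < q - f i" using S'(3) by auto
        then show "p < f y \<and> f y < q" by linarith
      qed
      moreover have "{p<..<q} \<subseteq> Z i"
        using e(2) p q by (force simp: ball_def dist_real_def)
      ultimately show ?thesis using S' p(1) q(1) by blast
    qed
    then obtain s p q where spq: "\<And>i. i \<in> T \<Longrightarrow> s i \<in> \<S> \<and> p i \<in> \<rat> \<and> q i \<in> \<rat> \<and> i \<in> s i \<and>
        (\<forall>y\<in>s i. p i < f y \<and> f y < q i) \<and> {p i<..<q i} \<subseteq> Z i" by metis
    let ?\<A> = "(\<lambda>i. W (s i, p i, q i)) ` ?J"
    have "finite ?\<A>"
      using Z(3) by (intro finite_imageI) (simp add: finite_subset)
    moreover have "?\<A> \<subseteq> ?A" using spq by blast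
    ultimately have "\<F> \<inter> \<Inter>?\<A> \<in> ?N" by blast
    moreover have "f \<in> \<F> \<inter> \<Inter>?\<A>"
      using spq V(3) unfolding W_def by auto
    moreover have "\<F> \<inter> \<Inter>?\<A> \<subseteq> U"
    proof
      fix g assume g: "g \<in> \<F> \<inter> \<Inter>?\<A>"
      have "g i \<in> Z i" for i
      proof (cases "i \<in> ?J")
        case True
        then have "g \<in> W (s i, p i, q i)" using g by blast
        then have "g i \<in> {p i<..<q i}" using spq True unfolding W_def by auto
        then show ?thesis using spq True by blast
      next
        case False
        have "f i \<in> Z i" using Z(1) by auto
        moreover have "g i = f i" if "i \<notin> T"
          using zero[of g i] zero[of f i] g V(3) that by auto
        ultimately show ?thesis using False by auto
      qed
      then show "g \<in> U" using Z(4) V(2) g by auto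
    qed
    ultimately show "\<exists>N\<in>?N. f \<in> N \<and> N \<subseteq> U"
      by (intro bexI[of _ "\<F> \<inter> \<Inter>?\<A>"] conjI)
  qed
  ultimately show ?thesis by (intro exI[of _ ?N] conjI)
qed

lemma subtopology_SCp:
  "\<F> \<subseteq> topspace (SCp X) \<Longrightarrow> subtopology (SCp X) \<F> = subtopology euclidean \<F>"
  unfolding SCp_def by (simp add: subtopology_subtopology inf.absorb2)

text \<open>The preceding lemmas apply with \<open>r\<close> the network weight of \<open>X\<close>
  itself, which is infinite by convention.\<close>

theorem network_weight_sigma_convex_le:
  assumes "countable_tightness X" "\<F> \<subseteq> topspace (SCp X)" "sigma_convex \<F>"
  shows "network_weight (subtopology (SCp X) \<F>) \<le>o network_weight X"
proof -
  obtain \<N> where N: "is_network X \<N>" "|\<N>| \<le>o network_weight X"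
    by (rule network_weight_witness)
  obtain \<S> where S: "|\<S>| \<le>o network_weight X" "value_network \<F> (topspace X) \<S>"
    using value_network_exists[OF assms N Cinfinite_network_weight] by (elim exE conjE)
  have "\<exists>\<M>. is_network (subtopology euclidean \<F>) \<M> \<and> |\<M>| \<le>o network_weight X"
  proof (rule network_of_value_network[OF _ S(2,1) Cinfinite_network_weight])
    show "f x = 0" if "f \<in> \<F>" "x \<notin> topspace X" for f x
      using assms(2) that unfolding SCp_def by auto
  qed
  then obtain \<M> where "is_network (subtopology (SCp X) \<F>) \<M>" "|\<M>| \<le>o network_weight X"
    unfolding subtopology_SCp[OF assms(2)] by (elim exE conjE)
  then show ?thesis
    using Cinfinite_network_weight by (rule network_weight_le)
qed

section \<open>Attaining the bound on completely regular spaces\<close>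

text \<open>Values are confined to the unit interval because a \<sigma>-convex set must be pointwise
  bounded, which fails for all continuous functions on a nonempty space.\<close>

definition continuous_unit :: "'a topology \<Rightarrow> ('a \<Rightarrow> real) set" where
  "continuous_unit X = {f. continuous_map X euclideanreal f \<and> (\<forall>x. 0 \<le> f x \<and> f x \<le> 1) \<and>
     (\<forall>x. x \<notin> topspace X \<longrightarrow> f x = 0)}"

lemma continuous_map_imp_scatteredly_continuous:
  assumes "continuous_map X Y f"
  shows "scatteredly_continuous X Y f"
  unfolding scatteredly_continuous_def
proof (intro conjI allI impI)
  show "f \<in> topspace X \<rightarrow> topspace Y" using assms by (simp add: continuous_map_def)
  fix A assume A: "A \<subseteq> topspace X \<and> A \<noteq> {}"
  then obtain x where "x \<in> A" by blast
  moreover have "topcontinuous_at (subtopology X A) Y f x"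
    using continuous_map_from_subtopology[OF assms, of A] A \<open>x \<in> A\<close>
    unfolding continuous_map_eq_topcontinuous_at by (simp add: subset_iff)
  ultimately show "\<exists>x\<in>A. topcontinuous_at (subtopology X A) Y f x" by blast
qed

lemma continuous_unit_subset_SCp: "continuous_unit X \<subseteq> topspace (SCp X)"
  unfolding continuous_unit_def SCp_def
  by (auto intro: continuous_map_imp_scatteredly_continuous)

text \<open>The weights \<open>t\<close> majorize the terms, so by the Weierstrass test the series
  converges uniformly and its sum is continuous.\<close>

lemma sigma_convex_continuous_unit: "sigma_convex (continuous_unit X)"
  unfolding sigma_convex_def
proof (intro allI impI)
  fix g :: "nat \<Rightarrow> 'a \<Rightarrow> real" and t :: "nat \<Rightarrow> real"
  assume H: "(\<forall>n. g n \<in> continuous_unit X) \<and> (\<forall>n. 0 < t n) \<and> t sums 1"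
  then have g: "\<And>n. continuous_map X euclideanreal (g n)" "\<And>n x. 0 \<le> g n x \<and> g n x \<le> 1"
      "\<And>n x. x \<notin> topspace X \<Longrightarrow> g n x = 0"
    and t: "\<And>n. 0 < t n" "t sums 1"
    unfolding continuous_unit_def by auto
  have t_sum: "summable t" using t(2) by (rule sums_summable)
  have le: "norm (t n * g n x) \<le> t n" for n x
    using g(2)[of n x] t(1)[of n] by (simp add: abs_mult mult_left_le)
  have summable: "summable (\<lambda>n. t n * g n x)" for x
    by (rule summable_comparison_test'[OF t_sum le])
  let ?c = "\<lambda>x. \<Sum>n. t n * g n x"
  have "uniform_limit UNIV (\<lambda>n x. \<Sum>i<n. t i * g i x) ?c sequentially"
    by (rule Weierstrass_m_test[OF le t_sum])
  then have unif: "\<forall>\<^sub>F n in sequentially. \<forall>x. dist (\<Sum>i<n. t i * g i x) (?c x) < e" if "e > 0" for e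
    using that by (simp add: uniform_limit_iff)
  have partial: "continuous_map X euclideanreal (\<lambda>x. \<Sum>i<n. t i * g i x)" for n
    using g(1) by (intro continuous_intros) auto
  have "continuous_map X Met_TC.mtopology ?c"
  proof (rule Met_TC.continuous_map_uniform_limit[of X "\<lambda>n x. \<Sum>i<n. t i * g i x" sequentially])
    show "\<forall>\<^sub>F n in sequentially. continuous_map X Met_TC.mtopology (\<lambda>x. \<Sum>i<n. t i * g i x)"
      using partial by simp
    show "\<forall>\<^sub>F n in sequentially. \<forall>x\<in>topspace X. ?c x \<in> UNIV \<and> dist (\<Sum>i<n. t i * g i x) (?c x) < e"
      if "e > 0" for e
      using unif[OF that] by (rule eventually_mono) simp
  qed simp
  then have "continuous_map X euclideanreal ?c" by simp
  moreover have "0 \<le> ?c x \<and> ?c x \<le> 1" for x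
  proof
    show "0 \<le> ?c x"
      using g(2) t(1) by (intro suminf_nonneg summable) (simp add: less_imp_le)
    have "?c x \<le> suminf t"
      using le by (intro suminf_le summable t_sum) (metis abs_le_D1 real_norm_def)
    then show "?c x \<le> 1" using t(2) by (simp add: sums_iff)
  qed
  ultimately have "?c \<in> continuous_unit X"
    using g(3) unfolding continuous_unit_def by simp
  moreover have "(\<lambda>n. t n *\<^sub>R g n) sums ?c"
    using summable by (simp add: sums_fun_iff summable_sums)
  ultimately show "\<exists>c\<in>continuous_unit X. (\<lambda>n. t n *\<^sub>R g n) sums c" by blast
qed

text \<open>Each \<open>x\<close> acts on the continuous functions by evaluation, so a network of these functions
  induces one of \<open>X\<close>.\<close>

lemma network_weight_le_continuous_unit:
  assumes "completely_regular_space X"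
  shows "network_weight X \<le>o network_weight (subtopology euclidean (continuous_unit X))"
proof -
  let ?F = "continuous_unit X"
  obtain \<M> where M: "is_network (subtopology euclidean ?F) \<M>"
      "|\<M>| \<le>o network_weight (subtopology euclidean ?F)"
    by (rule network_weight_witness)
  \<comment> \<open>The threshold 1/2 separates the values 1 and 0 that the function
    \<open>f\<close> below takes at \<open>x\<close> and outside \<open>U\<close>.\<close>
  let ?P = "\<lambda>W. {x \<in> topspace X. \<forall>f\<in>W. f x > (1/2::real)}"
  have "is_network X (?P ` \<M>)"
    unfolding is_network_def
  proof (intro conjI allI impI)
    show "?P ` \<M> \<subseteq> Pow (topspace X)" by auto
  next
    fix U x assume U: "openin X U \<and> x \<in> U"
    then have x: "x \<in> topspace X" "x \<in> U" using openin_subset by auto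
    have "closedin X (topspace X - U)" "x \<in> topspace X - (topspace X - U)" using U x by auto
    then obtain h :: "'a \<Rightarrow> real" where h: "continuous_map X (top_of_set {0..1}) h" "h x = 0" "h ` (topspace X - U) \<subseteq> {1}"
      using assms unfolding completely_regular_space_def by blast
    define f where "f y = (if y \<in> topspace X then 1 - h y else 0)" for y
    have "continuous_map X euclideanreal h" and h01: "\<And>y. y \<in> topspace X \<Longrightarrow> 0 \<le> h y \<and> h y \<le> 1"
      using h(1) by (auto simp: continuous_map_in_subtopology)
    then have "continuous_map X euclideanreal (\<lambda>y. 1 - h y)"
      by (intro continuous_intros)
    then have "continuous_map X euclideanreal f"
      by (rule continuous_map_eq) (simp add: f_def)
    then have f: "f \<in> ?F" using h01 unfolding continuous_unit_def f_def by auto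
    have "open {g :: 'a \<Rightarrow> real. g x > 1/2}"
      by (intro open_Collect_less continuous_intros continuous_on_product_coordinates)
    then have "openin (subtopology euclidean ?F) (?F \<inter> {g. g x > 1/2})"
      by (auto simp: openin_open)
    moreover have "f x > 1/2" using x h(2) by (simp add: f_def)
    then have "f \<in> ?F \<inter> {g. g x > 1/2}" using f by simp
    ultimately obtain W where W: "W \<in> \<M>" "f \<in> W" "W \<subseteq> ?F \<inter> {g. g x > 1/2}"
      using M(1) unfolding is_network_def by blast
    \<comment> \<open>Since \<open>f\<close> itself lies in \<open>W\<close> and vanishes outside
      \<open>U\<close>, no point outside \<open>U\<close> can belong to \<open>?P W\<close>.\<close>
    have "y \<in> U" if "y \<in> ?P W" for y
    proof (rule ccontr)
      assume "y \<notin> U"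
      then have "h y = 1" using h(3) that by blast
      then have "f y = 0" by (simp add: f_def)
      then show False using that W(2) by force
    qed
    then show "\<exists>N\<in>?P ` \<M>. x \<in> N \<and> N \<subseteq> U"
      using W x by (intro bexI[of _ "?P W"]) auto
  qed
  then show ?thesis
    using card_of_image_le[OF M(2)] Cinfinite_network_weight by (rule network_weight_le)
qed

theorem corollary1:
  fixes X :: "'a topology"
  assumes "countable_tightness X"
  shows "(\<forall>\<F>. \<F> \<subseteq> topspace (SCp X) \<and> sigma_convex \<F>
            \<longrightarrow> network_weight (subtopology (SCp X) \<F>) \<le>o network_weight X) \<and>
         (tychonoff_space X \<longrightarrow>
            is_maximum_cardinal (network_weight X)
              {network_weight (subtopology (SCp X) \<F>) | \<F>.
                 \<F> \<subseteq> topspace (SCp X) \<and> sigma_convex \<F>})"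
proof (intro conjI impI)
  show le: "\<forall>\<F>. \<F> \<subseteq> topspace (SCp X) \<and> sigma_convex \<F>
      \<longrightarrow> network_weight (subtopology (SCp X) \<F>) \<le>o network_weight X"
    using network_weight_sigma_convex_le[OF assms] by blast
  \<comment> \<open>The set \<open>continuous_unit X\<close> attains the maximum: one inequality
    comes from complete regularity, the other from the first claim.\<close>
  assume "tychonoff_space X"
  then have "network_weight X \<le>o network_weight (subtopology (SCp X) (continuous_unit X))"
    unfolding tychonoff_space_def
    by (simp add: network_weight_le_continuous_unit subtopology_SCp[OF continuous_unit_subset_SCp])
  then have "network_weight X =o network_weight (subtopology (SCp X) (continuous_unit X))"
    using le continuous_unit_subset_SCp sigma_convex_continuous_unit
    unfolding ordIso_iff_ordLeq by blast
  then show "is_maximum_cardinal (network_weight X)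
      {network_weight (subtopology (SCp X) \<F>) | \<F>. \<F> \<subseteq> topspace (SCp X) \<and> sigma_convex \<F>}"
    unfolding is_maximum_cardinal_def
    using le continuous_unit_subset_SCp sigma_convex_continuous_unit by blast
qed

end
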